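(* Let $\mathfrak{g}=A_{5,4}$ and let $\langle\cdot,\cdot\rangle$ be an inner product on $\mathfrak{g}$. Let $\eta>0$ and let $\{v_1,\dots,v_5\}$ be a basis of $\mathfrak{g}$, orthonormal with respect to $\eta\langle\cdot,\cdot\rangle$, whose only nonzero brackets (up to antisymmetry) are $[v_1,v_3]=\alpha v_5$, $[v_1,v_4]=\beta v_5$, $[v_2,v_3]=\gamma v_5$, with $\beta,\gamma>0$ and $\alpha\in\mathbb{R}$. Then $\langle\cdot,\cdot\rangle$ is a Schouten like metric if and only if $\alpha=0$ and $\beta=\gamma$.
   Context: $A_{5,4}$ is the five-dimensional real nilpotent Lie algebra having a basis with the brackets displayed in the claim. An inner product on $\mathfrak{g}$ is identified with the left-invariant Riemannian metric $g$ it induces on the simply connected Lie group $G$ with Lie algebra $\mathfrak{g}$. Let $ric_g$ be the Ricci curvature tensor of $(G,g)$ (Levi-Civita connection), viewed as a symmetric bilinear form on $\mathfrak{g}$; since $\mathfrak{g}$ is nilpotent, $ric_g(u,v)=-\frac12\mathrm{tr}(ad_u\circ ad_v^* )-\frac14\mathrm{tr}(J_u\circ J_v)$, where $ad_uv=[u,v]$, $ad_v^*$ is the $g$-transpose of $ad_v$, and $J_uv=ad_v^*u$. The Ricci operator $Ric_g$ is defined by $ric_g(u,v)=g(Ric_g(u),v)$ and $s=\mathrm{tr}(Ric_g)$ is the scalar curvature. A derivation $D$ of $\mathfrak{g}$ is symmetric with respect to $g$ if $g(Du,v)=g(u,Dv)$ for all $u,v$. The metric $g$ is a Schouten like metric if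 there are real numbers $\lambda_0,c$ and a derivation $D$ of $\mathfrak{g}$, symmetric with respect to $g$, such that $ric_g(X,Y)=(s\lambda_0+c)g(X,Y)+g(D(X),Y)$ for all $X,Y\in\mathfrak{g}$. *)

theory Defs
  imports "HOL-Analysis.Linear_Algebra"
begin

definition lie_bracket :: "('a::real_vector \<Rightarrow> 'a \<Rightarrow> 'a) \<Rightarrow> bool" where
  "lie_bracket br \<longleftrightarrow> bilinear br \<and> (\<forall>x. br x x = 0) \<and>
     (\<forall>x y z. br x (br y z) + br y (br z x) + br z (br x y) = 0)"

fun lower_central :: "('a::real_vector \<Rightarrow> 'a \<Rightarrow> 'a) \<Rightarrow> nat \<Rightarrow> 'a set" where
  "lower_central br 0 = UNIV"
| "lower_central br (Suc n) = span {br x y | x y. y \<in> lower_central br n}"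

definition nilpotent_bracket :: "('a::real_vector \<Rightarrow> 'a \<Rightarrow> 'a) \<Rightarrow> bool" where
  "nilpotent_bracket br \<longleftrightarrow> (\<exists>n. lower_central br n = {0})"

definition derivation :: "('a::real_vector \<Rightarrow> 'a \<Rightarrow> 'a) \<Rightarrow> ('a \<Rightarrow> 'a) \<Rightarrow> bool" where
  "derivation br D \<longleftrightarrow> linear D \<and> (\<forall>x y. D (br x y) = br (D x) y + br x (D y))"

definition basis5 :: "(nat \<Rightarrow> 'a::real_vector) \<Rightarrow> bool" where
  "basis5 v \<longleftrightarrow> inj_on v {1..5} \<and> independent (v ` {1..5}) \<and> span (v ` {1..5}) = UNIV"

definition brackets_A54 ::
    "('a::real_vector \<Rightarrow> 'a \<Rightarrow> 'a) \<Rightarrow> (nat \<Rightarrow> 'a) \<Rightarrow> real \<Rightarrow> real \<Rightarrow> real \<Rightarrow> bool" where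
  "brackets_A54 br v \<alpha> \<beta> \<gamma> \<longleftrightarrow>
     br (v 1) (v 3) = \<alpha> *\<^sub>R v 5 \<and>
     br (v 1) (v 4) = \<beta> *\<^sub>R v 5 \<and>
     br (v 2) (v 3) = \<gamma> *\<^sub>R v 5 \<and>
     (\<forall>i\<in>{1..5}. \<forall>j\<in>{1..5}. i < j \<and> (i, j) \<notin> {(1, 3), (1, 4), (2, 3)} \<longrightarrow> br (v i) (v j) = 0)"

(* "The Lie algebra is A_{5,4}", as a property invariant under isomorphism: for all values of
   the parameters with beta, gamma > 0 these brackets define isomorphic Lie algebras. *)
definition is_A54 :: "('a::real_vector \<Rightarrow> 'a \<Rightarrow> 'a) \<Rightarrow> bool" where
  "is_A54 br \<longleftrightarrow> lie_bracket br \<and> nilpotent_bracket br \<and> dim (UNIV :: 'a set) = 5 \<and>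
     (\<exists>e \<alpha> \<beta> \<gamma>. basis5 e \<and> \<beta> > 0 \<and> \<gamma> > 0 \<and> brackets_A54 br e \<alpha> \<beta> \<gamma>)"

definition inner_product :: "('a::real_vector \<Rightarrow> 'a \<Rightarrow> real) \<Rightarrow> bool" where
  "inner_product g \<longleftrightarrow> bilinear g \<and> (\<forall>x y. g x y = g y x) \<and> (\<forall>x. x \<noteq> 0 \<longrightarrow> g x x > 0)"

definition orthonormal5 :: "('a::real_vector \<Rightarrow> 'a \<Rightarrow> real) \<Rightarrow> (nat \<Rightarrow> 'a) \<Rightarrow> bool" where
  "orthonormal5 g v \<longleftrightarrow> (\<forall>i\<in>{1..5}. \<forall>j\<in>{1..5}. g (v i) (v j) = (if i = j then 1 else 0))"

(* Trace of an endomorphism of a finite-dimensional space; it does not depend on the choice of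
   the basis B, and no inner product enters. *)
definition endo_trace :: "('a::real_vector \<Rightarrow> 'a) \<Rightarrow> real" where
  "endo_trace f = (let B = (SOME B. independent B \<and> span B = UNIV)
                   in \<Sum>b\<in>B. representation B (f b) b)"

(* The Levi-Civita connection of the left-invariant metric g. It maps left-invariant fields to
   left-invariant fields, so it is determined by a bilinear product on the Lie algebra. As g is
   constant on left-invariant fields, metric compatibility says that nabla u is g-skew. *)
definition levi_civita ::
    "('a::real_vector \<Rightarrow> 'a \<Rightarrow> 'a) \<Rightarrow> ('a \<Rightarrow> 'a \<Rightarrow> real) \<Rightarrow> 'a \<Rightarrow> 'a \<Rightarrow> 'a" where
  "levi_civita br g = (THE nabla. bilinear nabla \<and>
     (\<forall>u v. nabla u v - nabla v u = br u v) \<and>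
     (\<forall>u v w. g (nabla u v) w + g v (nabla u w) = 0))"

definition curvature ::
    "('a::real_vector \<Rightarrow> 'a \<Rightarrow> 'a) \<Rightarrow> ('a \<Rightarrow> 'a \<Rightarrow> real) \<Rightarrow> 'a \<Rightarrow> 'a \<Rightarrow> 'a \<Rightarrow> 'a" where
  "curvature br g u v w = (let nabla = levi_civita br g
     in nabla u (nabla v w) - nabla v (nabla u w) - nabla (br u v) w)"

(* With these sign conventions round spheres have positive Ricci curvature, and for nilpotent
   brackets ricci u v = -1/2 tr (ad_u o ad_v^* ) - 1/4 tr (J_u o J_v), where J_u v = ad_v^* u. *)
definition ricci ::
    "('a::real_vector \<Rightarrow> 'a \<Rightarrow> 'a) \<Rightarrow> ('a \<Rightarrow> 'a \<Rightarrow> real) \<Rightarrow> 'a \<Rightarrow> 'a \<Rightarrow> real" where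
  "ricci br g u v = endo_trace (\<lambda>w. curvature br g w u v)"

definition ricci_operator ::
    "('a::real_vector \<Rightarrow> 'a \<Rightarrow> 'a) \<Rightarrow> ('a \<Rightarrow> 'a \<Rightarrow> real) \<Rightarrow> 'a \<Rightarrow> 'a" where
  "ricci_operator br g = (THE A. \<forall>u v. ricci br g u v = g (A u) v)"

definition scalar_curvature ::
    "('a::real_vector \<Rightarrow> 'a \<Rightarrow> 'a) \<Rightarrow> ('a \<Rightarrow> 'a \<Rightarrow> real) \<Rightarrow> real" where
  "scalar_curvature br g = endo_trace (ricci_operator br g)"

definition schouten_like ::
    "('a::real_vector \<Rightarrow> 'a \<Rightarrow> 'a) \<Rightarrow> ('a \<Rightarrow> 'a \<Rightarrow> real) \<Rightarrow> bool" where
  "schouten_like br g \<longleftrightarrow> (\<exists>(l0::real) (c::real) D.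
     derivation br D \<and> (\<forall>u v. g (D u) v = g u (D v)) \<and>
     (\<forall>x y. ricci br g x y = (scalar_curvature br g * l0 + c) * g x y + g (D x) y))"

end

theory Submission
  imports Defs
begin

text \<open>The bracket is a skew form \<open>a\<close> times \<open>v\<^sub>5\<close>. Let \<open>J\<close> represent \<open>a\<close> with respect to
  \<open>h = \<eta> g\<close>. The Koszul formula gives the connection, and hence the Ricci form
  \<open>- h(J x, J y) / 2 + (\<alpha>\<^sup>2 + \<beta>\<^sup>2 + \<gamma>\<^sup>2) x\<^sub>5 y\<^sub>5 / 2\<close>. A Schouten like metric makes
  \<open>Ric - k id\<close> a derivation for some \<open>k\<close>. Applied to \<open>[v\<^sub>2, v\<^sub>4] = 0\<close> the derivation rule
  forces \<open>\<alpha> = 0\<close>; the two values of \<open>k\<close> obtained from \<open>[v\<^sub>1, v\<^sub>4]\<close> and \<open>[v\<^sub>2, v\<^sub>3]\<close> then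
  agree only if \<open>\<beta> = \<gamma>\<close>. Conversely, \<open>\<lambda>\<^sub>0 = 0\<close> and \<open>c = - 2 \<eta> \<beta>\<^sup>2\<close> work.\<close>

text \<open>The identity is the sum of the maps x -> \<open>c i x *\<^sub>R v i\<close>. Expanding
  \<open>f b\<close> this way, exchanging the sums and reassembling each \<open>v i\<close> from its
  \<open>B\<close>-coordinates replaces the unknown basis \<open>B\<close> by the frame.\<close>

lemma endo_trace_frame:
  fixes f :: "'a::real_vector \<Rightarrow> 'a" and c :: "'i \<Rightarrow> 'a \<Rightarrow> real"
  assumes "linear f" and "finite I" and c: "\<And>i. i \<in> I \<Longrightarrow> linear (c i)"
    and expand: "\<And>x. x = (\<Sum>i\<in>I. c i x *\<^sub>R v i)"
  shows "endo_trace f = (\<Sum>i\<in>I. c i (f (v i)))"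
proof -
  define B :: "'a set" where "B = (SOME B. independent B \<and> span B = UNIV)"
  have "\<exists>B::'a set. independent B \<and> span B = UNIV"
    using maximal_independent_subset[of "UNIV::'a set"] by (metis top.extremum_uniqueI)
  then have B: "independent B" "span B = UNIV"
    unfolding B_def by (metis (mono_tags, lifting) someI_ex)+
  have "x \<in> span (v ` I)" for x
    by (subst expand) (intro span_sum span_scale span_base imageI)
  then have fin: "finite B"
    using independent_span_bound[of "v ` I" B] B \<open>finite I\<close> by blast
  have "(\<Sum>b\<in>B. representation B (f b) b)
      = (\<Sum>b\<in>B. \<Sum>i\<in>I. c i (f b) * representation B (v i) b)"
  proof (rule sum.cong[OF refl])
    fix b
    have "representation B (f b) b = representation B (\<Sum>i\<in>I. c i (f b) *\<^sub>R v i) b"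
      using expand[of "f b"] by simp
    then show "representation B (f b) b = (\<Sum>i\<in>I. c i (f b) * representation B (v i) b)"
      by (simp add: representation_sum[OF B(1)] representation_scale[OF B(1)] B(2))
  qed
  also have "\<dots> = (\<Sum>i\<in>I. c i (f (\<Sum>b\<in>B. representation B (v i) b *\<^sub>R b)))"
    by (subst sum.swap)
      (simp add: linear_sum[OF \<open>linear f\<close>] linear_scale[OF \<open>linear f\<close>]
        linear_sum[OF c] linear_scale[OF c] mult.commute)
  also have "\<dots> = (\<Sum>i\<in>I. c i (f (v i)))"
    by (simp add: sum_representation_eq[OF B(1) _ fin] B(2))
  finally show ?thesis
    by (simp add: endo_trace_def B_def)
qed

section \<open>Koszul formula and uniqueness of the Levi-Civita connection\<close>

lemma
  assumes "inner_product g"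
  shows inner_product_bilinear: "bilinear g"
    and inner_product_commute: "g x y = g y x"
  using assms unfolding inner_product_def by blast+

lemma inner_product_eqI:
  assumes "inner_product g" and "\<And>w. g x w = g y w"
  shows "x = y"
proof (rule ccontr)
  assume "x \<noteq> y"
  then have "g (x - y) (x - y) > 0"
    using assms(1) by (simp add: inner_product_def)
  moreover have "g (x - y) (x - y) = 0"
    using assms(2) by (simp add: bilinear_lsub[OF inner_product_bilinear[OF assms(1)]])
  ultimately show False by simp
qed

text \<open>Combine metric compatibility for the three cyclic permutations of u, v, w. The
  derivative terms of the general formula vanish because g is constant on left-invariant
  fields.\<close>

lemma koszul_formula:
  assumes "inner_product g"
    and torsion_free: "\<And>u v. N u v - N v u = br u v"
    and metric: "\<And>u v w. g (N u v) w + g v (N u w) = 0"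
  shows "2 * g (N u v) w = g (br u v) w - g (br v w) u + g (br w u) v"
proof -
  note sub = bilinear_lsub[OF inner_product_bilinear[OF assms(1)]]
  note comm = inner_product_commute[OF assms(1)]
  show ?thesis
    using metric[of u v w] metric[of v w u] metric[of w u v]
    by (simp add: torsion_free[symmetric] sub comm[of _ "N _ _"])
qed

text \<open>The right-hand side of the Koszul formula does not contain the connection, so
  nondegeneracy of g gives the uniqueness that \<open>THE\<close> requires.\<close>

lemma levi_civita_eqI:
  assumes "inner_product g" and "bilinear N"
    and "\<And>u v. N u v - N v u = br u v"
    and "\<And>u v w. g (N u v) w + g v (N u w) = 0"
  shows "levi_civita br g = N"
  unfolding levi_civita_def
proof (rule the_equality)
  fix N' assume N': "bilinear N' \<and> (\<forall>u v. N' u v - N' v u = br u v) \<and>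
     (\<forall>u v w. g (N' u v) w + g v (N' u w) = 0)"
  have "g (N' u v) w = g (N u v) w" for u v w
    using koszul_formula[of g N br, OF assms(1,3,4)] koszul_formula[of g N' br u v w] N' assms(1)
    by (metis mult_left_cancel zero_neq_numeral)
  then show "N' = N"
    by (intro ext inner_product_eqI[OF assms(1)])
qed (use assms in auto)

section \<open>Coordinates in the orthonormal frame\<close>

locale A54_frame =
  fixes br :: "'a::real_vector \<Rightarrow> 'a \<Rightarrow> 'a"
    and g :: "'a \<Rightarrow> 'a \<Rightarrow> real"
    and v :: "nat \<Rightarrow> 'a"
    and \<eta> \<alpha> \<beta> \<gamma> :: real
  assumes bracket: "lie_bracket br"
    and inner: "inner_product g"
    and pos: "\<eta> > 0"
    and basis: "basis5 v"
    and orthonormal: "orthonormal5 (\<lambda>x y. \<eta> * g x y) v"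
    and brackets: "brackets_A54 br v \<alpha> \<beta> \<gamma>"
begin

text \<open>Keeps the index 1 from becoming \<open>Suc 0\<close>, so that rules about
  \<open>v 1\<close> and \<open>coord 1\<close> still match.\<close>

declare One_nat_def [simp del]

text \<open>The dual basis of \<open>v\<close>, written as h-inner products: linearity is immediate,
  and \<open>coord j (D x)\<close> can be read off from \<open>g (D x) (v j)\<close>.\<close>

definition coord :: "nat \<Rightarrow> 'a \<Rightarrow> real" where
  "coord i x = \<eta> * g x (v i)"

lemma linear_coord: "linear (coord i)"
  using inner_product_bilinear[OF inner]
  by (intro linearI) (simp_all add: coord_def bilinear_ladd bilinear_lmul algebra_simps)

lemmas coord_linear [simp] = linear_add[OF linear_coord] linear_diff[OF linear_coord]
  linear_neg[OF linear_coord] linear_scale[OF linear_coord] linear_0[OF linear_coord]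

lemma coord_basis:
  "i \<in> {1..5} \<Longrightarrow> j \<in> {1..5} \<Longrightarrow> coord i (v j) = (if i = j then 1 else 0)"
  using orthonormal by (auto simp: coord_def orthonormal5_def)

lemma sum_1_to_5: "(\<Sum>i\<in>{1..5}. f i) = f 1 + f 2 + f 3 + f 4 + f (5::nat)"
proof -
  have "{1..5::nat} = {1, 2, 3, 4, 5}" by auto
  then show ?thesis by (simp add: add.assoc)
qed

lemma ball_1_to_5: "(\<forall>i\<in>{1..5::nat}. P i) \<longleftrightarrow> P 1 \<and> P 2 \<and> P 3 \<and> P 4 \<and> P 5"
proof -
  have "{1..5::nat} = {1, 2, 3, 4, 5}" by auto
  then show ?thesis by simp
qed

lemma coord_basis_simps [simp]:
  assumes "i \<in> {1..5}"
  shows "coord i (v 1) = (if i = 1 then 1 else 0)" "coord i (v 2) = (if i = 2 then 1 else 0)"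
    "coord i (v 3) = (if i = 3 then 1 else 0)" "coord i (v 4) = (if i = 4 then 1 else 0)"
    "coord i (v 5) = (if i = 5 then 1 else 0)"
  using assms coord_basis by auto

lemma span_basis: "span (v ` {1..5}) = UNIV"
  using basis by (simp add: basis5_def)

lemma expansion: "x = (\<Sum>i\<in>{1..5}. coord i x *\<^sub>R v i)"
proof -
  have "id x = (\<Sum>i\<in>{1..5}. coord i x *\<^sub>R v i)"
  proof (rule linear_eq_on_span[of id _ "v ` {1..5}"])
    show "linear (\<lambda>x. \<Sum>i\<in>{1..5}. coord i x *\<^sub>R v i)"
      by (intro linear_compose_sum ballI linearI) (auto simp: scaleR_add_left)
    show "id y = (\<Sum>i\<in>{1..5}. coord i y *\<^sub>R v i)" if "y \<in> v ` {1..5}" for y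
    proof -
      have "\<forall>j\<in>{1..5}. v j = (\<Sum>i\<in>{1..5}. coord i (v j) *\<^sub>R v i)"
        unfolding ball_1_to_5 sum_1_to_5 by simp
      with that show ?thesis by auto
    qed
  qed (simp_all add: span_basis linear_id)
  then show ?thesis by simp
qed

lemma coord_eqI:
  assumes "\<And>i. i \<in> {1..5} \<Longrightarrow> coord i x = coord i y"
  shows "x = y"
  using expansion[of x] expansion[of y] assms by (metis (no_types, lifting) sum.cong)

lemma inner_coord:
  "\<eta> * g x y = coord 1 x * coord 1 y + coord 2 x * coord 2 y + coord 3 x * coord 3 y
    + coord 4 x * coord 4 y + coord 5 x * coord 5 y"
proof -
  have lin: "linear (\<lambda>y. \<eta> * g x y)"
    using inner_product_bilinear[OF inner]
    by (intro linearI) (simp_all add: bilinear_radd bilinear_rmul algebra_simps)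
  have "\<eta> * g x y = (\<lambda>y. \<eta> * g x y) (\<Sum>i\<in>{1..5}. coord i y *\<^sub>R v i)"
    using expansion[of y] by simp
  also have "\<dots> = (\<Sum>i\<in>{1..5}. coord i y * coord i x)"
    by (simp only: linear_sum[OF lin] linear_scale[OF lin] coord_def real_scaleR_def)
  finally show ?thesis
    by (simp add: sum_1_to_5 mult.commute)
qed

section \<open>Bracket, connection and Ricci form in coordinates\<close>

definition form :: "'a \<Rightarrow> 'a \<Rightarrow> real" where
  "form x y = \<alpha> * (coord 1 x * coord 3 y - coord 3 x * coord 1 y)
    + \<beta> * (coord 1 x * coord 4 y - coord 4 x * coord 1 y)
    + \<gamma> * (coord 2 x * coord 3 y - coord 3 x * coord 2 y)"

lemma bilinear_form: "bilinear (\<lambda>x y. form x y *\<^sub>R z)"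
  by (auto simp: bilinear_def form_def algebra_simps intro!: linearI)

lemma bilinear_bracket: "bilinear br"
  using bracket by (simp add: lie_bracket_def)

lemma bracket_form: "br x y = form x y *\<^sub>R v 5"
proof -
  note bil = bilinear_bracket
  have self: "br x x = 0" for x
    using bracket by (auto simp: lie_bracket_def)
  have skew: "br y x = - br x y" for x y
    using self[of "x + y"] self[of x] self[of y]
    by (simp add: bilinear_ladd[OF bil] bilinear_radd[OF bil] eq_neg_iff_add_eq_0 add.commute)
  have "\<forall>i\<in>{1..5}. \<forall>j\<in>{1..5}. br (v i) (v j) = form (v i) (v j) *\<^sub>R v 5"
    using brackets
    unfolding brackets_A54_def ball_1_to_5
    by (simp add: form_def self skew[of _ "v 1"] skew[of "v 3" "v 2"] skew[of "v 4" "v 2"]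
        skew[of "v 5" "v 2"] skew[of "v 4" "v 3"] skew[of "v 5" "v 3"] skew[of "v 5" "v 4"])
  then show ?thesis
    using bilinear_eq[OF bil bilinear_form, of UNIV "v ` {1..5}" UNIV "v ` {1..5}" x y "v 5"]
    by (auto simp: span_basis)
qed

text \<open>Characterized by \<open>form x y\<close> = \<open>\<eta> * g (J x) y\<close>. This is
  the operator J_u of the general Ricci formula for u = \<open>v 5\<close>.\<close>

definition J :: "'a \<Rightarrow> 'a" where
  "J x = - (\<alpha> * coord 3 x + \<beta> * coord 4 x) *\<^sub>R v 1 - (\<gamma> * coord 3 x) *\<^sub>R v 2
    + (\<alpha> * coord 1 x + \<gamma> * coord 2 x) *\<^sub>R v 3 + (\<beta> * coord 1 x) *\<^sub>R v 4"

text \<open>The Koszul formula solved for the connection: h([y, z], x) = \<open>coord 5 x\<close>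
  h(J y, z), and likewise with x and y exchanged.\<close>

definition nabla :: "'a \<Rightarrow> 'a \<Rightarrow> 'a" where
  "nabla x y = (1/2) *\<^sub>R (form x y *\<^sub>R v 5 - coord 5 y *\<^sub>R J x - coord 5 x *\<^sub>R J y)"

lemma bilinear_nabla: "bilinear nabla"
  by (auto simp: bilinear_def nabla_def J_def form_def intro!: linearI coord_eqI)
    (simp_all add: field_simps)

lemma levi_civita_eq: "levi_civita br g = nabla"
proof (rule levi_civita_eqI[OF inner bilinear_nabla])
  show "nabla x y - nabla y x = br x y" for x y
    by (rule coord_eqI) (simp add: nabla_def bracket_form form_def field_simps)
  \<comment> \<open>Scaled by \<eta> because \<open>inner_coord\<close> evaluates \<eta> g rather
    than g.\<close>
  have "\<eta> * (g (nabla x y) z + g y (nabla x z)) = 0" for x y z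
    unfolding distrib_left inner_coord
    by (simp add: nabla_def J_def form_def field_simps)
  then show "g (nabla x y) z + g y (nabla x z) = 0" for x y z
    using pos by simp
qed

lemma ricci_eq:
  "ricci br g x y =
    - (\<eta> * g (J x) (J y)) / 2 + (\<alpha>\<^sup>2 + \<beta>\<^sup>2 + \<gamma>\<^sup>2) / 2 * coord 5 x * coord 5 y"
proof -
  have "linear (\<lambda>w. curvature br g w x y)"
    unfolding curvature_def levi_civita_eq Let_def
    using bilinear_nabla bilinear_bracket
    by (intro linearI)
      (simp_all add: bilinear_ladd bilinear_radd bilinear_lmul bilinear_rmul algebra_simps)
  then have "ricci br g x y = (\<Sum>i\<in>{1..5}. coord i (curvature br g (v i) x y))"
    unfolding ricci_def
    by (intro endo_trace_frame[of _ _ coord] linear_coord expansion) auto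
  also have "\<dots> = - (\<eta> * g (J x) (J y)) / 2
      + (\<alpha>\<^sup>2 + \<beta>\<^sup>2 + \<gamma>\<^sup>2) / 2 * coord 5 x * coord 5 y"
    unfolding sum_1_to_5 curvature_def levi_civita_eq Let_def bracket_form inner_coord
    by (simp add: nabla_def J_def form_def) (simp add: field_simps power2_eq_square)
  finally show ?thesis .
qed

section \<open>The two directions of the equivalence\<close>

lemma schouten_like_imp:
  assumes "\<beta> > 0" and "\<gamma> > 0" and "schouten_like br g"
  shows "\<alpha> = 0 \<and> \<beta> = \<gamma>"
proof -
  obtain k D where D: "derivation br D"
    and ric: "\<And>x y. ricci br g x y = k * g x y + g (D x) y"
    using assms(3) unfolding schouten_like_def by metis
  have coord_D: "coord j (D x) = \<eta> * ricci br g x (v j) - k * coord j x" for j x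
    by (simp add: ric coord_def algebra_simps)
  have lin: "linear D" and der: "D (br x y) = br (D x) y + br x (D y)" for x y
    using D by (auto simp: derivation_def)
  \<comment> \<open>All brackets are multiples of \<open>v 5\<close>, so the derivation rule is read
    off in the fifth coordinate.\<close>
  have der5: "form x y * coord 5 (D (v 5)) = form (D x) y + form x (D y)" for x y
    using arg_cong[OF der[of x y], of "coord 5"]
    by (simp add: bracket_form linear_scale[OF lin])
  \<comment> \<open>The \<open>v 1\<close> component of \<open>D (v 2)\<close> and the
    \<open>v 3\<close> component of \<open>D (v 4)\<close> each contribute
    -\<eta>\<alpha>\<beta>\<gamma>/2 to the bracket rule.\<close>
  have "\<eta> * (\<alpha> * \<beta> * \<gamma>) = 0"
    using der5[of "v 2" "v 4"]
    by (simp add: form_def coord_D ricci_eq inner_coord J_def algebra_simps)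
  then have \<alpha>: "\<alpha> = 0"
    using pos assms by simp
  \<comment> \<open>Once \<alpha> = 0, the frame diagonalizes \<open>D\<close>; the eigenvalues at
    \<open>v 1\<close> and \<open>v 4\<close> must add up to the one at \<open>v 5\<close>.\<close>
  have "\<beta> * (\<eta> * (\<alpha>\<^sup>2 + \<beta>\<^sup>2 + \<gamma>\<^sup>2) / 2 + k + \<eta> * \<beta>\<^sup>2) = 0"
    using der5[of "v 1" "v 4"]
    unfolding form_def coord_D ricci_eq inner_coord J_def
    by (simp add: \<alpha> power2_eq_square algebra_simps)
  moreover have "\<gamma> * (\<eta> * (\<alpha>\<^sup>2 + \<beta>\<^sup>2 + \<gamma>\<^sup>2) / 2 + k + \<eta> * \<gamma>\<^sup>2) = 0"
    using der5[of "v 2" "v 3"]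
    unfolding form_def coord_D ricci_eq inner_coord J_def
    by (simp add: \<alpha> power2_eq_square algebra_simps)
  ultimately have "\<eta> * \<beta>\<^sup>2 = \<eta> * \<gamma>\<^sup>2"
    using assms(1,2) unfolding mult_eq_0_iff by linarith
  then have "\<beta>\<^sup>2 = \<gamma>\<^sup>2"
    using pos by simp
  with \<alpha> show ?thesis
    using assms by (simp add: power2_eq_iff_nonneg)
qed

lemma schouten_likeI:
  assumes "\<alpha> = 0" and "\<beta> = \<gamma>"
  shows "schouten_like br g"
proof -
  \<comment> \<open>The Ricci eigenvalues are now -\<eta>\<beta>^2/2 on \<open>v 1\<close>, ...,
    \<open>v 4\<close> and \<eta>\<beta>^2 on \<open>v 5\<close>. Subtracting k = -2\<eta>\<beta>^2
    makes the last one twice the others, which is the derivation giving \<open>v 5\<close> weight 2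
    and the other basis vectors weight 1.\<close>
  define D where "D x = (3 / 2 * \<eta> * \<beta>\<^sup>2) *\<^sub>R (x + coord 5 x *\<^sub>R v 5)" for x
  have "linear D"
    by (intro linearI) (simp_all add: D_def algebra_simps)
  moreover have "D (br x y) = br (D x) y + br x (D y)" for x y
    by (rule coord_eqI) (simp add: D_def bracket_form form_def algebra_simps)
  ultimately have "derivation br D"
    by (simp add: derivation_def)
  moreover have "\<eta> * g (D x) y = \<eta> * g x (D y)" for x y
    unfolding inner_coord by (simp add: D_def algebra_simps)
  then have "\<forall>x y. g (D x) y = g x (D y)"
    using pos by simp
  moreover have "\<eta> * ricci br g x y = \<eta> * ((- 2 * \<eta> * \<beta>\<^sup>2) * g x y + g (D x) y)" for x y
    unfolding distrib_left mult.left_commute[of \<eta> _ "g _ _"] ricci_eq inner_coord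
      J_def D_def
    by (simp add: assms power2_eq_square field_simps)
  then have "\<forall>x y. ricci br g x y = (scalar_curvature br g * 0 + - 2 * \<eta> * \<beta>\<^sup>2) * g x y + g (D x) y"
    using pos by simp
  ultimately show ?thesis
    unfolding schouten_like_def by blast
qed

end

theorem proposition4:
  fixes br :: "'a::real_vector \<Rightarrow> 'a \<Rightarrow> 'a"
    and g :: "'a \<Rightarrow> 'a \<Rightarrow> real"
    and v :: "nat \<Rightarrow> 'a"
    and \<eta> \<alpha> \<beta> \<gamma> :: real
  assumes "is_A54 br"
    and "inner_product g"
    and "\<eta> > 0"
    and "basis5 v"
    and "orthonormal5 (\<lambda>x y. \<eta> * g x y) v"
    and "brackets_A54 br v \<alpha> \<beta> \<gamma>"
    and "\<beta> > 0" and "\<gamma> > 0"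
  shows "schouten_like br g \<longleftrightarrow> \<alpha> = 0 \<and> \<beta> = \<gamma>"
proof -
  interpret A54_frame br g v \<eta> \<alpha> \<beta> \<gamma>
    using assms by unfold_locales (auto simp: is_A54_def)
  show ?thesis
    using schouten_like_imp schouten_likeI assms by blast
qed

end
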